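(* Let $\mathbb{M}$ be a strongly regular sequence admitting a nonzero proximate order, let $e,E$ be an associated pair of kernel functions for $\mathbb{M}$-summability, and let $m=(m(p))_{p\ge 0}$ be the associated sequence of moments. Let $n\ge 1$ and let $A\in\mathbb{C}^{n\times n}$ be a diagonalizable matrix. Let $\{\lambda_j\}_{1\le j\le k}$, for some $1\le k\le n$, be the set of (pairwise distinct) eigenvalues of $A$, and for every $1\le j\le k$ let $\{v_{j,1},\ldots,v_{j,\ell_j}\}$, with $\ell_j\ge 1$, be a basis of $\mathrm{Ker}(A-\lambda_j I_n)$. Then the general solution of the system $\partial_m y=Ay$ is $$y(z)=\sum_{j=1}^{k}\sum_{p=1}^{\ell_j}C_{j,p}\,E(\lambda_j z)\,v_{j,p},$$ where the $C_{j,p}\in\mathbb{C}$ are arbitrary constants; that is, every function of this form is a solution, and every solution is of this form for some choice of the constants $C_{j,p}$.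
   Context: Strongly regular sequence: a sequence $\mathbb{M}=(M_p)_{p\ge0}$ of positive reals with $M_0=1$ such that (lc) $M_p^2\le M_{p-1}M_{p+1}$ for $p\ge1$; (mg) there is $A_1>0$ with $M_{p+q}\le A_1^{p+q}M_pM_q$ for all $p,q\ge0$; (snq) there is $A_2>0$ with $\sum_{q\ge p}\frac{M_q}{(q+1)M_{q+1}}\le A_2\frac{M_p}{M_{p+1}}$ for all $p\ge0$. Put $M(0)=0$, $M(t)=\sup_{p\ge0}\log(t^p/M_p)$ for $t>0$, $\rho(M)=\limsup_{r\to\infty}\max\{0,\log M(r)/\log r\}$, and $\omega(\mathbb{M})=1/\rho(M)$. Nonzero proximate order: a nonnegative $C^1$ function $\rho(t)$ on some $(c,\infty)$ with $\lim_{r\to\infty}\rho(r)=\rho>0$ and $\lim_{r\to\infty}r\rho'(r)\ln r=0$. The sequence $\mathbb{M}$ admits the nonzero proximate order $\rho(t)$ if $\log(t)\left(\rho(t)-\frac{\log M(t)}{\log t}\right)$ is bounded for $t$ large. Sectors: $S_d(\theta)=\{z:|\arg(z)-d|<\theta/2\}$ (on the Riemann surface of the logarithm). $D(z_0,r)$ is the open disc. Pair of kernel functions for $\mathbb{M}$-summability ($0<\omega(\mathbb{M})<2$): functions $e,E$ such that (1) $e$ is holomorphic on $S_0(\omega(\mathbb{M})\pi)$; there is $t_0>0$ such that for every $z_0\in S_0(\omega(\mathbb{M})\pi)$ there is $r_0>0$ with $D(z_0,r_0)\subseteq S_0(\omega(\mathbb{M})\pi)$ and $\int_0^{t_0}\sup_{z\in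 D(z_0,r_0)}|e(t/z)|\frac{dt}{t}<\infty$; and for every $\delta>0$ there are $k_1,k_2>0$ with $|e(z)|\le k_1\exp(-M(|z|/k_2))$ on $S_0(\omega(\mathbb{M})\pi-\delta)$. (2) $e(|z|)\in\mathbb{R}$ for all $z\in S_0(\omega(\mathbb{M})\pi)$. (3) $E$ is entire, there are $k_3,k_4>0$ with $|E(z)|\le k_3\exp(M(|z|/k_4))$ on $\mathbb{C}$, and there is $\beta>0$ such that for all $0<\theta<2\pi-\omega(\mathbb{M})\pi$ and $R>0$ there is $k_5>0$ with $|E(z)|\le k_5|z|^{-\beta}$ for $z\in S_\pi(\theta)$, $|z|\ge R$. (4) $E(z)=\sum_{p\ge0}\frac{z^p}{m(p)}$, where $m(z)=\int_0^\infty t^{z-1}e(t)\,dt$ for $\mathrm{Re}(z)\ge0$ is continuous there and holomorphic for $\mathrm{Re}(z)>0$. The sequence $m=(m(p))_{p\ge0}$ (of positive reals) is the sequence of moments. If $\mathbb{M}$ admits a nonzero proximate order, such a pair exists, and it is fixed. Moment derivative: $\partial_m\left(\sum_{p\ge0}\frac{a_p}{m(p)}z^p\right)=\sum_{p\ge0}\frac{a_{p+1}}{m(p)}z^p$ on $\mathbb{C}[[z]]$, extended to functions holomorphic near $0$ via Taylor expansion at $0$, and to vectors componentwise. A solution of $\partial_m y=Ay$ is a vector $y=(y_1,\ldots,y_n)^T$ of such functions satisfying the equation. *)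

theory Defs
  imports "HOL-Complex_Analysis.Complex_Analysis"
begin

section \<open>Strongly regular sequences\<close>

definition strongly_regular :: "(nat \<Rightarrow> real) \<Rightarrow> bool" where
  "strongly_regular M \<longleftrightarrow>
     (\<forall>p. 0 < M p) \<and> M 0 = 1 \<and>
     (\<forall>p\<ge>1. (M p)\<^sup>2 \<le> M (p - 1) * M (p + 1)) \<and>
     (\<exists>A1>0. \<forall>p q. M (p + q) \<le> A1 ^ (p + q) * M p * M q) \<and>
     (\<exists>A2>0.
        summable (\<lambda>q. M q / (real (q + 1) * M (q + 1))) \<and>
        (\<forall>p. (\<Sum>q. M (p + q) / (real (p + q + 1) * M (p + q + 1))) \<le> A2 * (M p / M (p + 1))))"

text \<open>
  For a strongly regular sequence the supremum below is over a set that is bounded above,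
  so that the real-valued \<^const>\<open>Sup\<close> is the intended supremum.
\<close>

definition assoc_fun :: "(nat \<Rightarrow> real) \<Rightarrow> real \<Rightarrow> real" where
  "assoc_fun M t = (if t > 0 then (SUP p. ln (t ^ p / M p)) else 0)"

definition growth_order :: "(nat \<Rightarrow> real) \<Rightarrow> ereal" where
  "growth_order M = Limsup at_top (\<lambda>r. ereal (max 0 (ln (assoc_fun M r) / ln r)))"

definition omega_index :: "(nat \<Rightarrow> real) \<Rightarrow> ereal" where
  "omega_index M = 1 / growth_order M"


section \<open>Proximate orders\<close>

definition nonzero_proximate_order :: "(real \<Rightarrow> real) \<Rightarrow> bool" where
  "nonzero_proximate_order \<rho> \<longleftrightarrow>
     (\<exists>c. (\<forall>t>c. 0 \<le> \<rho> t) \<and>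
          (\<forall>t>c. \<rho> differentiable (at t)) \<and>
          continuous_on {c<..} (deriv \<rho>)) \<and>
     (\<exists>\<rho>0>0. (\<rho> \<longlongrightarrow> \<rho>0) at_top) \<and>
     ((\<lambda>r. r * deriv \<rho> r * ln r) \<longlongrightarrow> 0) at_top"

definition admits_proximate_order :: "(nat \<Rightarrow> real) \<Rightarrow> (real \<Rightarrow> real) \<Rightarrow> bool" where
  "admits_proximate_order M \<rho> \<longleftrightarrow>
     Bfun (\<lambda>t. ln t * (\<rho> t - ln (assoc_fun M t) / ln t)) at_top"


section \<open>Kernel functions and moments\<close>

text \<open>
  The projection to the punctured plane of the sector with bisecting direction \<open>d\<close> and opening
  \<open>\<theta>\<close>. Only openings below \<open>2 * pi\<close> occur here, for which the projection is injective.
\<close>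

definition sector :: "real \<Rightarrow> real \<Rightarrow> complex set" where
  "sector d \<theta> = {z. \<exists>r \<phi>. 0 < r \<and> \<bar>\<phi> - d\<bar> < \<theta> / 2 \<and> z = of_real r * cis \<phi>}"

definition moment_fun :: "(complex \<Rightarrow> complex) \<Rightarrow> complex \<Rightarrow> complex" where
  "moment_fun e z =
     set_lebesgue_integral lborel {0<..} (\<lambda>t. of_real t powr (z - 1) * e (of_real t))"

text \<open>
  The integral in the second clause is taken in the extended nonnegative reals, so its finiteness
  is the finiteness required of it. The integral defining \<^const>\<open>moment_fun\<close> converges absolutely
  for \<open>Re z \<ge> 0\<close> because of the second and third clauses.
\<close>

definition kernel_pair ::
  "(nat \<Rightarrow> real) \<Rightarrow> (complex \<Rightarrow> complex) \<Rightarrow> (complex \<Rightarrow> complex) \<Rightarrow> bool" where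
  "kernel_pair M e E \<longleftrightarrow>
     0 < omega_index M \<and> omega_index M < 2 \<and>
     (let \<omega> = real_of_ereal (omega_index M); S = sector 0 (\<omega> * pi) in
        e holomorphic_on S \<and>
        (\<exists>t0>0. \<forall>z0\<in>S. \<exists>r0>0. ball z0 r0 \<subseteq> S \<and>
           set_nn_integral lborel {0<..t0}
             (\<lambda>t. (SUP z\<in>ball z0 r0. ennreal (norm (e (of_real t / z)))) * ennreal (1 / t)) < \<infinity>) \<and>
        (\<forall>\<delta>>0. \<exists>k1>0. \<exists>k2>0. \<forall>z\<in>sector 0 (\<omega> * pi - \<delta>).
           norm (e z) \<le> k1 * exp (- assoc_fun M (norm z / k2))) \<and>
        (\<forall>z\<in>S. e (of_real (norm z)) \<in> \<real>) \<and>
        E holomorphic_on UNIV \<and>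
        (\<exists>k3>0. \<exists>k4>0. \<forall>z. norm (E z) \<le> k3 * exp (assoc_fun M (norm z / k4))) \<and>
        (\<exists>\<beta>>0. \<forall>\<theta> R. 0 < \<theta> \<and> \<theta> < 2 * pi - \<omega> * pi \<and> 0 < R \<longrightarrow>
           (\<exists>k5>0. \<forall>z\<in>sector pi \<theta>. R \<le> norm z \<longrightarrow> norm (E z) \<le> k5 * norm z powr (- \<beta>))) \<and>
        continuous_on {z. 0 \<le> Re z} (moment_fun e) \<and>
        moment_fun e holomorphic_on {z. 0 < Re z} \<and>
        (\<forall>z. (\<lambda>p. z ^ p / moment_fun e (of_nat p)) sums E z))"

definition moment_sequence :: "(complex \<Rightarrow> complex) \<Rightarrow> (nat \<Rightarrow> real) \<Rightarrow> bool" where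
  "moment_sequence e m \<longleftrightarrow>
     (\<forall>p. 0 < m p \<and> complex_of_real (m p) = moment_fun e (of_nat p))"


section \<open>Moment derivative\<close>

text \<open>
  A series with coefficients \<open>f\<^sub>p\<close> is written with \<open>a\<^sub>p / m(p) = f\<^sub>p\<close>, that is, \<open>a\<^sub>p = m(p) f\<^sub>p\<close>.
\<close>

definition moment_deriv_fps :: "(nat \<Rightarrow> real) \<Rightarrow> complex fps \<Rightarrow> complex fps" where
  "moment_deriv_fps m F =
     Abs_fps (\<lambda>p. of_real (m (Suc p)) * fps_nth F (Suc p) / of_real (m p))"

lemma moment_deriv_fps_Abs_fps:
  assumes "\<And>p. m p > 0"
  shows "moment_deriv_fps m (Abs_fps (\<lambda>p. a p / of_real (m p))) =
         Abs_fps (\<lambda>p. a (Suc p) / of_real (m p))"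
proof -
  have "m p \<noteq> 0" for p
    using assms[of p] by simp
  then show ?thesis
    by (simp add: moment_deriv_fps_def fps_eq_iff)
qed

text \<open>
  \<open>has_moment_deriv m f g\<close>: the function \<open>f\<close> is holomorphic near \<open>0\<close>, and the moment derivative
  of its Taylor series at \<open>0\<close> converges near \<open>0\<close> to the function \<open>g\<close>.
\<close>

definition has_moment_deriv ::
  "(nat \<Rightarrow> real) \<Rightarrow> (complex \<Rightarrow> complex) \<Rightarrow> (complex \<Rightarrow> complex) \<Rightarrow> bool" where
  "has_moment_deriv m f g \<longleftrightarrow>
     f analytic_on {0} \<and> g has_fps_expansion moment_deriv_fps m (fps_expansion f 0)"

text \<open>
  Intended for an open connected \<open>U\<close> containing \<open>0\<close>: functions holomorphic on \<open>U\<close> that satisfy the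
  equation as germs at \<open>0\<close>, the moment derivative being given by Taylor expansion there.
\<close>

definition moment_solution_on ::
  "(nat \<Rightarrow> real) \<Rightarrow> complex ^ 'n ^ 'n \<Rightarrow> complex set \<Rightarrow> (complex \<Rightarrow> complex ^ 'n) \<Rightarrow> bool" where
  "moment_solution_on m A U y \<longleftrightarrow>
     (\<forall>i. (\<lambda>z. vec_nth (y z) i) holomorphic_on U) \<and>
     (\<forall>i. has_moment_deriv m (\<lambda>z. vec_nth (y z) i) (\<lambda>z. vec_nth (A *v y z) i))"


section \<open>Diagonalizable matrices\<close>

definition diagonalizable :: "'a::field ^ 'n ^ 'n \<Rightarrow> bool" where
  "diagonalizable A \<longleftrightarrow>
     (\<exists>P D :: 'a ^ 'n ^ 'n. invertible P \<and> (\<forall>i j. i \<noteq> j \<longrightarrow> vec_nth (vec_nth D i) j = 0) \<and>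
            A = P ** D ** matrix_inv P)"

definition eigenvalues :: "'a::field ^ 'n ^ 'n \<Rightarrow> 'a set" where
  "eigenvalues A = {\<mu>. \<exists>x. x \<noteq> 0 \<and> A *v x = \<mu> *s x}"

end

theory Submission
  imports Defs
begin

text \<open>
  On Taylor coefficients at \<open>0\<close>, the equation \<open>\<partial>\<^sub>m y = A y\<close> for
  \<open>y = \<Sum>\<^sub>p c\<^sub>p z\<^sup>p\<close> is the recurrence \<open>m(p+1) c\<^sub>p\<^sub>+\<^sub>1 = A (m(p) c\<^sub>p)\<close>, so that
  \<open>m(p) c\<^sub>p = A\<^sup>p (m(0) c\<^sub>0)\<close>: the initial value determines the germ of a solution. If
  \<open>m(0) c\<^sub>0 = v\<close> with \<open>A v = \<lambda> v\<close>, then \<open>c\<^sub>p = \<lambda>\<^sup>p v / m(p)\<close>, and the series is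
  \<open>E(\<lambda> z) v\<close> because \<open>E(z) = \<Sum>\<^sub>p z\<^sup>p / m(p)\<close>.
  The eigenvectors of a diagonalizable matrix span the whole space
  (\<open>diagonalizable_eigenvectors_span\<close>), so superposition of these solutions reaches every initial
  value. A solution on \<open>U\<close> hence has the same Taylor series at \<open>0\<close> as some combination, and the
  identity theorem extends their equality from a neighbourhood of \<open>0\<close> to the connected set \<open>U\<close>
  (\<open>moment_solution_on_iff_eigen_combination\<close>).
\<close>

section \<open>Linear algebra: eigenvectors of a diagonalizable matrix\<close>

text \<open>
  Coefficients are attached to indices rather than to vectors, so that bases of several subspaces
  can be concatenated into one family.
\<close>

lemma span_image_finite_family:
  fixes w :: "'b \<Rightarrow> 'a::field ^ 'n"
  assumes "finite I" and "x \<in> vec.span (w ` I)"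
  obtains C where "x = (\<Sum>b\<in>I. C b *s w b)"
proof -
  let ?S = "{x. \<exists>C. x = (\<Sum>b\<in>I. C b *s w b)}"
  have "vec.subspace ?S"
  proof (rule vec.subspaceI)
    have "0 = (\<Sum>b\<in>I. 0 *s w b)" by simp
    then show "0 \<in> ?S" by (intro CollectI exI)
  next
    fix x y assume "x \<in> ?S" "y \<in> ?S"
    then obtain C D where "x = (\<Sum>b\<in>I. C b *s w b)" "y = (\<Sum>b\<in>I. D b *s w b)" by blast
    then have "x + y = (\<Sum>b\<in>I. (C b + D b) *s w b)"
      by (simp add: sum.distrib vec.scale_left_distrib)
    then show "x + y \<in> ?S" by (intro CollectI exI)
  next
    fix a x assume "x \<in> ?S"
    then obtain C where "x = (\<Sum>b\<in>I. C b *s w b)" by blast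
    then have "a *s x = (\<Sum>b\<in>I. (a * C b) *s w b)"
      by (simp add: vec.scale_sum_right vec.scale_scale)
    then show "a *s x \<in> ?S" by (intro CollectI exI)
  qed
  moreover have "w ` I \<subseteq> ?S"
  proof clarify
    fix a assume "a \<in> I"
    then have "(\<Sum>b\<in>I. (if b = a then 1 else 0) *s w b) = w a"
      using \<open>finite I\<close> by (simp add: if_distrib[where f = "\<lambda>t. t *s _"] cong: if_cong)
    then show "\<exists>C. w a = (\<Sum>b\<in>I. C b *s w b)" by (intro exI) (rule sym)
  qed
  ultimately show thesis
    using vec.span_minimal assms(2) that by blast
qed

text \<open>
  If \<open>A = P D P\<^sup>-\<^sup>1\<close> with \<open>D\<close> diagonal, the columns of \<open>P\<close> are eigenvectors of \<open>A\<close>, and they span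
  because \<open>P\<close> is surjective.
\<close>

lemma diagonalizable_eigenvectors_span:
  fixes A :: "'a::field ^ 'n ^ 'n"
  assumes "diagonalizable A"
  shows "vec.span {x. \<exists>\<mu>\<in>eigenvalues A. A *v x = \<mu> *s x} = UNIV"
proof -
  from assms obtain P D :: "'a ^ 'n ^ 'n" where P: "invertible P"
    and D: "\<And>i j. i \<noteq> j \<Longrightarrow> D $ i $ j = 0" and A: "A = P ** D ** matrix_inv P"
    unfolding diagonalizable_def by blast
  have inv: "matrix_inv P ** P = mat 1" "P ** matrix_inv P = mat 1"
    using someI_ex[OF P[unfolded invertible_def]] by (simp_all add: matrix_inv_def)
  have AP: "A ** P = P ** D"
    unfolding A by (simp add: matrix_mul_assoc[symmetric] inv)
  have eig: "A *v column i P = D $ i $ i *s column i P" for i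
  proof -
    have "(A *v column i P) $ r = (P ** D) $ r $ i" for r
      unfolding AP[symmetric] by (simp add: matrix_vector_mult_def matrix_matrix_mult_def column_def)
    also have "(P ** D) $ r $ i = P $ r $ i * D $ i $ i" for r
      unfolding matrix_matrix_mult_def using D
      by (simp add: sum.remove[of UNIV i])
    finally show ?thesis by (simp add: vec_eq_iff column_def mult.commute)
  qed
  have nz: "column i P \<noteq> 0" for i
  proof
    assume *: "column i P = 0"
    have "(matrix_inv P ** P) $ i $ i = (matrix_inv P *v column i P) $ i"
      by (simp add: matrix_vector_mult_def matrix_matrix_mult_def column_def)
    with * inv show False by (simp add: mat_def)
  qed
  have col: "column i P \<in> {x. \<exists>\<mu>\<in>eigenvalues A. A *v x = \<mu> *s x}" for i
    using eig[of i] nz[of i] unfolding eigenvalues_def by blast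
  have "x \<in> vec.span {x. \<exists>\<mu>\<in>eigenvalues A. A *v x = \<mu> *s x}" for x
  proof -
    have "x = P *v (matrix_inv P *v x)"
      by (simp add: matrix_vector_mul_assoc inv)
    also have "\<dots> = (\<Sum>i\<in>UNIV. (matrix_inv P *v x) $ i *s column i P)"
      by (rule matrix_mult_sum)
    also have "\<dots> \<in> vec.span {x. \<exists>\<mu>\<in>eigenvalues A. A *v x = \<mu> *s x}"
      by (intro vec.span_sum vec.span_scale vec.span_base col)
    finally show ?thesis .
  qed
  then show ?thesis by blast
qed

section \<open>The system on Taylor coefficients\<close>

lemma has_moment_deriv_iff_has_fps_expansion:
  assumes "f has_fps_expansion F"
  shows "has_moment_deriv m f g \<longleftrightarrow> g has_fps_expansion moment_deriv_fps m F"
  using assms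
  by (simp add: has_moment_deriv_def fps_expansion_eqI has_fps_expansion_imp_analytic_0)

text \<open>
  By uniqueness of Taylor series this is a comparison of coefficients. The two halves of the factor
  \<open>m(p+1) / m(p)\<close> of the moment derivative are put on different sides, so that the recurrence is an
  iteration of \<open>A\<close> on the vectors \<open>m(p) c\<^sub>p\<close>.
\<close>

lemma moment_system_iff_recurrence:
  fixes A :: "complex ^ 'n ^ 'n" and y :: "complex \<Rightarrow> complex ^ 'n"
  assumes m: "\<And>p. m p > 0"
    and y: "\<And>i. (\<lambda>z. y z $ i) has_fps_expansion Abs_fps (\<lambda>p. c p $ i)"
  shows "(\<forall>i. has_moment_deriv m (\<lambda>z. y z $ i) (\<lambda>z. (A *v y z) $ i)) \<longleftrightarrow>
         (\<forall>p. of_real (m (Suc p)) *s c (Suc p) = A *v (of_real (m p) *s c p))"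
proof -
  have Ay: "(\<lambda>z. (A *v y z) $ i) has_fps_expansion Abs_fps (\<lambda>p. (A *v c p) $ i)" for i
  proof (rule has_fps_expansion_schematicI)
    show "(\<lambda>z. (A *v y z) $ i) has_fps_expansion
            (\<Sum>j\<in>UNIV. fps_const (A $ i $ j) * Abs_fps (\<lambda>p. c p $ j))"
      unfolding matrix_vector_mult_def vec_lambda_beta
      by (intro has_fps_expansion_sum has_fps_expansion_cmult_left y)
  qed (simp add: fps_eq_iff fps_sum_nth matrix_vector_mult_def)
  have "has_moment_deriv m (\<lambda>z. y z $ i) (\<lambda>z. (A *v y z) $ i) \<longleftrightarrow>
          (\<forall>p. of_real (m (Suc p)) * c (Suc p) $ i = of_real (m p) * (A *v c p) $ i)" for i
  proof -
    have "has_moment_deriv m (\<lambda>z. y z $ i) (\<lambda>z. (A *v y z) $ i) \<longleftrightarrow>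
            moment_deriv_fps m (Abs_fps (\<lambda>p. c p $ i)) = Abs_fps (\<lambda>p. (A *v c p) $ i)"
      unfolding has_moment_deriv_iff_has_fps_expansion[OF y]
      using Ay fps_expansion_unique_complex by metis
    also have "\<dots> \<longleftrightarrow>
        (\<forall>p. of_real (m (Suc p)) * c (Suc p) $ i / of_real (m p) = (A *v c p) $ i)"
      by (simp add: moment_deriv_fps_def fps_eq_iff)
    also have "\<dots> \<longleftrightarrow>
        (\<forall>p. of_real (m (Suc p)) * c (Suc p) $ i = of_real (m p) * (A *v c p) $ i)"
      using less_imp_neq[OF m] by (simp add: divide_eq_eq mult.commute)
    finally show ?thesis .
  qed
  then show ?thesis
    by (auto simp: vec_eq_iff vector_scalar_commute)
qed

section \<open>Solutions as combinations of eigenvectors\<close>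

lemma kernel_dilation_has_fps_expansion:
  fixes E :: "complex \<Rightarrow> complex"
  assumes "\<And>z. (\<lambda>p. z ^ p / a p) sums E z"
  shows "(\<lambda>z. E (\<mu> * z)) has_fps_expansion Abs_fps (\<lambda>p. \<mu> ^ p / a p)"
  using assms[of "\<mu> * _"]
  by (intro has_fps_expansionI always_eventually allI) (simp add: power_mult_distrib)

text \<open>
  Multiplying the \<open>p\<close>-th coefficient by \<open>m(p)\<close> turns the recurrence into iteration of \<open>A\<close>, which
  acts on the coordinates with respect to \<open>w\<close> by multiplication with the eigenvalues. Choosing
  coordinates of \<open>m(0) y(0)\<close> thus produces a combination with the Taylor series of \<open>y\<close>; connectedness
  of \<open>U\<close> does the rest.
\<close>

lemma moment_solution_on_iff_eigen_combination:
  fixes A :: "complex ^ 'n ^ 'n" and y :: "complex \<Rightarrow> complex ^ 'n" and w :: "'b \<Rightarrow> complex ^ 'n"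
  assumes m: "\<And>p. m p > 0"
    and E: "\<And>z. (\<lambda>p. z ^ p / of_real (m p)) sums E z" and holE: "E holomorphic_on UNIV"
    and I: "finite I" and eig: "\<And>b. b \<in> I \<Longrightarrow> A *v w b = \<mu> b *s w b"
    and span: "vec.span (w ` I) = UNIV"
    and U: "open U" "connected U" "0 \<in> U"
  shows "moment_solution_on m A U y \<longleftrightarrow>
           (\<exists>C. \<forall>z\<in>U. y z = (\<Sum>b\<in>I. (C b * E (\<mu> b * z)) *s w b))"
proof -
  define comb where "comb C z = (\<Sum>b\<in>I. (C b * E (\<mu> b * z)) *s w b)" for C z
  define coef where "coef C p = (\<Sum>b\<in>I. (C b * (\<mu> b ^ p / of_real (m p))) *s w b)" for C p
  have m0: "complex_of_real (m p) \<noteq> 0" for p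
    using m[of p] by simp
  have comb_fps: "(\<lambda>z. comb C z $ i) has_fps_expansion Abs_fps (\<lambda>p. coef C p $ i)" for C i
  proof (rule has_fps_expansion_schematicI)
    show "(\<lambda>z. comb C z $ i) has_fps_expansion
        (\<Sum>b\<in>I. fps_const (C b) * Abs_fps (\<lambda>p. \<mu> b ^ p / of_real (m p)) * fps_const (w b $ i))"
      unfolding comb_def sum_component vector_smult_component
      by (intro has_fps_expansion_sum has_fps_expansion_cmult_left has_fps_expansion_cmult_right
          kernel_dilation_has_fps_expansion E)
  qed (simp add: coef_def fps_eq_iff fps_sum_nth)
  have comb_hol: "(\<lambda>z. comb C z $ i) holomorphic_on U" for C i
  proof -
    have "(\<lambda>z. E (\<mu> b * z)) holomorphic_on U" for b
      using holomorphic_on_compose_gen[OF _ holE, of "\<lambda>z. \<mu> b * z" U]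
      by (simp add: o_def holomorphic_intros)
    then show ?thesis
      unfolding comb_def sum_component vector_smult_component by (intro holomorphic_intros)
  qed
  have m_coef: "of_real (m p) *s coef C p = (\<Sum>b\<in>I. (C b * \<mu> b ^ p) *s w b)" for C p
    using m0[of p] by (simp add: coef_def vec.scale_sum_right vec.scale_scale mult.commute)
  have step: "A *v (\<Sum>b\<in>I. (C b * \<mu> b ^ p) *s w b) = (\<Sum>b\<in>I. (C b * \<mu> b ^ Suc p) *s w b)" for C p
    by (simp add: vec.linear_sum[OF matrix_vector_mul_linear_gen] vector_scalar_commute eig
        vec.scale_scale mult_ac)
  have comb_solves: "has_moment_deriv m (\<lambda>z. comb C z $ i) (\<lambda>z. (A *v comb C z) $ i)" for C i
    using moment_system_iff_recurrence[where m = m and A = A, OF m comb_fps] by (simp add: m_coef step)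
  show ?thesis
  proof
    assume sol: "moment_solution_on m A U y"
    have hol: "(\<lambda>z. y z $ i) holomorphic_on U" for i
      using sol by (simp add: moment_solution_on_def)
    define c where "c p = (\<chi> i. fps_nth (fps_expansion (\<lambda>z. y z $ i) 0) p)" for p
    have y_fps: "(\<lambda>z. y z $ i) has_fps_expansion Abs_fps (\<lambda>p. c p $ i)" for i
      using has_fps_expansion_fps_expansion[OF U(1,3) hol] by (simp add: c_def fps_nth_inverse)
    have rec: "of_real (m (Suc p)) *s c (Suc p) = A *v (of_real (m p) *s c p)" for p
      using moment_system_iff_recurrence[where m = m and A = A, OF m y_fps] sol
      by (simp add: moment_solution_on_def)
    obtain C where C: "of_real (m 0) *s c 0 = (\<Sum>b\<in>I. C b *s w b)"
      using span_image_finite_family[OF I, of "of_real (m 0) *s c 0" w] span by auto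
    have m_c: "of_real (m p) *s c p = (\<Sum>b\<in>I. (C b * \<mu> b ^ p) *s w b)" for p
      by (induction p) (simp_all add: C rec step del: power_Suc)
    have c: "c p = coef C p" for p
      using m_c[of p] m0[of p] by (simp flip: m_coef)
    have "y z $ i = comb C z $ i" if "z \<in> U" for z i
    proof -
      have "(\<lambda>z. y z $ i - comb C z $ i) has_fps_expansion 0"
        using has_fps_expansion_diff[OF y_fps[of i] comb_fps[of C i]] by (simp add: c)
      then have "y z $ i - comb C z $ i = 0"
        by (rule has_fps_expansion_0_analytic_continuation)
           (use U that hol comb_hol in \<open>auto intro!: holomorphic_intros\<close>)
      then show ?thesis by simp
    qed
    then show "\<exists>C. \<forall>z\<in>U. y z = (\<Sum>b\<in>I. (C b * E (\<mu> b * z)) *s w b)"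
      by (intro exI[of _ C]) (simp add: vec_eq_iff flip: comb_def)
  next
    assume "\<exists>C. \<forall>z\<in>U. y z = (\<Sum>b\<in>I. (C b * E (\<mu> b * z)) *s w b)"
    then obtain C where C: "\<And>z. z \<in> U \<Longrightarrow> y z = comb C z"
      unfolding comb_def by blast
    \<comment> \<open>The moment derivative depends only on the germ at \<open>0\<close>, where \<open>y\<close> and the combination agree.\<close>
    have germ: "eventually (\<lambda>z. y z = comb C z) (nhds 0)"
      using eventually_nhds_in_open[OF U(1,3)] by eventually_elim (rule C)
    have y_fps: "(\<lambda>z. y z $ i) has_fps_expansion Abs_fps (\<lambda>p. coef C p $ i)" for i
      using germ by (subst has_fps_expansion_cong[OF _ refl, where g = "\<lambda>z. comb C z $ i"])
        (auto elim: eventually_mono intro: comb_fps)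
    have "\<forall>i. has_moment_deriv m (\<lambda>z. y z $ i) (\<lambda>z. (A *v y z) $ i)"
      using moment_system_iff_recurrence[where m = m and A = A, OF m y_fps]
        moment_system_iff_recurrence[where m = m and A = A, OF m comb_fps[of C]] comb_solves by blast
    moreover have "(\<lambda>z. y z $ i) holomorphic_on U" for i
      using comb_hol[of C i] C by (subst holomorphic_cong[OF refl, where g = "\<lambda>z. comb C z $ i"]) auto
    ultimately show "moment_solution_on m A U y"
      by (simp add: moment_solution_on_def)
  qed
qed

section \<open>The general solution\<close>

theorem theorem1:
  fixes M m :: "nat \<Rightarrow> real"
    and e E :: "complex \<Rightarrow> complex"
    and A :: "complex ^ 'n ^ 'n"
    and k :: nat and l :: "nat \<Rightarrow> nat"
    and ev :: "nat \<Rightarrow> complex"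
    and v :: "nat \<Rightarrow> nat \<Rightarrow> complex ^ 'n"
    and U :: "complex set"
    and y :: "complex \<Rightarrow> complex ^ 'n"
  assumes "strongly_regular M"
    and "\<exists>\<rho>. nonzero_proximate_order \<rho> \<and> admits_proximate_order M \<rho>"
    and "kernel_pair M e E"
    and "moment_sequence e m"
    and "diagonalizable A"
    and "1 \<le> k" and "k \<le> CARD('n)"
    and "inj_on ev {1..k}" and "ev ` {1..k} = eigenvalues A"
    and "\<And>j. j \<in> {1..k} \<Longrightarrow> 1 \<le> l j"
    and "\<And>j. j \<in> {1..k} \<Longrightarrow> inj_on (v j) {1..l j}"
    and "\<And>j. j \<in> {1..k} \<Longrightarrow> vec.independent (v j ` {1..l j})"
    and "\<And>j. j \<in> {1..k} \<Longrightarrow> vec.span (v j ` {1..l j}) = {x. (A - mat (ev j)) *v x = 0}"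
    and "open U" and "connected U" and "0 \<in> U"
  shows "moment_solution_on m A U y \<longleftrightarrow>
           (\<exists>C :: nat \<Rightarrow> nat \<Rightarrow> complex. \<forall>z\<in>U.
              y z = (\<Sum>j=1..k. \<Sum>p=1..l j. (C j p * E (ev j * z)) *s v j p))"
proof -
  \<comment> \<open>All the eigenbases, concatenated into one family indexed by the pairs \<open>(j, p)\<close>.\<close>
  define I where "I = Sigma {1..k} (\<lambda>j. {1..l j})"
  define w where "w = (\<lambda>(j, p). v j p)"
  have m: "m p > 0" and mom: "complex_of_real (m p) = moment_fun e (of_nat p)" for p
    using \<open>moment_sequence e m\<close> by (simp_all add: moment_sequence_def)
  have E: "(\<lambda>p. z ^ p / of_real (m p)) sums E z" for z
    using \<open>kernel_pair M e E\<close> by (simp add: kernel_pair_def Let_def mom)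
  have holE: "E holomorphic_on UNIV"
    using \<open>kernel_pair M e E\<close> by (simp add: kernel_pair_def Let_def)
  have eigenspace: "x \<in> vec.span (v j ` {1..l j}) \<longleftrightarrow> A *v x = ev j *s x" if "j \<in> {1..k}" for j x
  proof -
    have "mat (ev j) *v x = ev j *s x"
      by (simp add: vec_eq_iff matrix_vector_mult_def mat_def if_distrib[where f = "\<lambda>t. t * _"]
          cong: if_cong)
    then show ?thesis
      using assms(13)[OF that] by (simp add: matrix_vector_mult_diff_rdistrib)
  qed
  have eig: "A *v w b = ev (fst b) *s w b" if "b \<in> I" for b
  proof -
    have "fst b \<in> {1..k}" and "w b \<in> v (fst b) ` {1..l (fst b)}"
      using that by (auto simp: I_def w_def)
    then show ?thesis
      using eigenspace vec.span_base by blast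
  qed
  have "{x. \<exists>\<mu>\<in>eigenvalues A. A *v x = \<mu> *s x} \<subseteq> vec.span (w ` I)"
  proof clarify
    fix x \<mu> assume "\<mu> \<in> eigenvalues A" and x: "A *v x = \<mu> *s x"
    then obtain j where j: "j \<in> {1..k}" "\<mu> = ev j"
      using assms(9) by blast
    have "v j ` {1..l j} \<subseteq> w ` I"
      using j by (force simp: I_def w_def)
    then show "x \<in> vec.span (w ` I)"
      using eigenspace[of j x] j x vec.span_mono by blast
  qed
  then have span: "vec.span (w ` I) = UNIV"
    using diagonalizable_eigenvectors_span[OF \<open>diagonalizable A\<close>]
      vec.span_minimal[OF _ vec.subspace_span] by blast
  have reindex: "(\<Sum>b\<in>I. (C b * E (ev (fst b) * z)) *s w b) =
      (\<Sum>j=1..k. \<Sum>p=1..l j. (C (j, p) * E (ev j * z)) *s v j p)" for C z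
    by (simp add: I_def w_def sum.Sigma case_prod_beta)
  have "finite I"
    by (simp add: I_def)
  then have sol: "moment_solution_on m A U y \<longleftrightarrow>
      (\<exists>C. \<forall>z\<in>U. y z = (\<Sum>b\<in>I. (C b * E (ev (fst b) * z)) *s w b))"
    by (rule moment_solution_on_iff_eigen_combination[where \<mu> = "\<lambda>b. ev (fst b)",
          OF m E holE _ eig span \<open>open U\<close> \<open>connected U\<close> \<open>0 \<in> U\<close>])
  have "moment_solution_on m A U y \<longleftrightarrow>
      (\<exists>C. \<forall>z\<in>U. y z = (\<Sum>j=1..k. \<Sum>p=1..l j. (C (j, p) * E (ev j * z)) *s v j p))"
    using sol by (simp only: reindex)
  also have "\<dots> \<longleftrightarrow> (\<exists>C. \<forall>z\<in>U. y z = (\<Sum>j=1..k. \<Sum>p=1..l j. (C j p * E (ev j * z)) *s v j p))"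
  proof (safe, goal_cases)
    case (1 C)
    then show ?case by (intro exI[of _ "curry C"]) simp
  next
    case (2 C)
    then show ?case by (intro exI[of _ "case_prod C"]) simp
  qed
  finally show ?thesis .
qed

end
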